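(* Let $(\Omega,\Sigma,\mu)$ be a probability space, let $T:\Omega\to\Omega$ be an invertible measure-preserving transformation, let $(a_k)_{k\in\mathbb{Z}}$ be a sequence of positive real numbers with $\sum_{k\in\mathbb{Z}}a_k=1$ and $\sum_{k\in\mathbb{Z}}\sqrt{a_k}<\infty$, and let $|||\cdot|||$ be the associated norm on $L_1(\mu)$, $$|||f|||=\int_\Omega\Big(\sum_{k\in\mathbb{Z}}a_k|f(T^k\omega)|^2\Big)^{1/2}d\mu(\omega),\qquad X=(L_1(\mu),|||\cdot|||).$$ Then the following assertions are equivalent: (1) $T$ is ergodic; (2) $|||\cdot|||$ is strictly convex; (3) $|||\cdot|||$ is Gâteaux smooth; (4) $X$ does not contain an isometric copy of $\ell_1^2$.
   Context: $L_1(\mu)$ is over $\mathbb{K}=\mathbb{R}$ or $\mathbb{C}$. An invertible measure-preserving transformation is a bijection $T:\Omega\to\Omega$ such that $T$ and $T^{-1}$ are measurable and $\mu(T^{-1}(A))=\mu(A)$ for every $A\in\Sigma$. It is ergodic if every $A\in\Sigma$ with $\mu(A\,\Delta\,T^{-1}(A))=0$ satisfies $\mu(A)=0$ or $\mu(A)=1$. The functional $|||\cdot|||$ is an equivalent norm on $L_1(\mu)$, with $\|f\|_1\le|||f|||\le(\sum_{k}\sqrt{a_k})\|f\|_1$. A Banach space $X$ with unit sphere $S_X$ (or its norm) is strictly convex if $\|\frac{x+y}{2}\|<1$ for all $x\neq y$ in $S_X$, and Gâteaux smooth if for every $x\in S_X$, $y\in X$ the limit $\lim_{t\to0}\frac{\|x+ty\|-\|x\|}{t}$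 ($t$ real) exists. $\ell_1^2$ is $\mathbb{K}^2$ with norm $\|(\alpha,\beta)\|=|\alpha|+|\beta|$; an isometric copy of it in $X$ is a linear subspace of $X$ linearly isometric to it. *)

theory Defs
  imports "HOL-Probability.Probability"
begin

text \<open>
  $L_1(\mu)$ depends on the measure, so it is not a type; normed spaces over the scalar type
  \<^typ>\<open>'k\<close> are therefore records with a carrier.
\<close>

record ('k, 'v) nspace =
  vcarrier :: "'v set"
  vadd :: "'v \<Rightarrow> 'v \<Rightarrow> 'v"
  vscale :: "'k \<Rightarrow> 'v \<Rightarrow> 'v"
  vnorm :: "'v \<Rightarrow> real"

definition unit_sphere :: "('k, 'v) nspace \<Rightarrow> 'v set" where
  "unit_sphere X = {x \<in> vcarrier X. vnorm X x = 1}"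

definition strictly_convex :: "('k::real_normed_field, 'v) nspace \<Rightarrow> bool" where
  "strictly_convex X \<longleftrightarrow>
     (\<forall>x\<in>unit_sphere X. \<forall>y\<in>unit_sphere X. x \<noteq> y \<longrightarrow>
        vnorm X (vscale X (1 / 2) (vadd X x y)) < 1)"

definition gateaux_smooth :: "('k::real_normed_field, 'v) nspace \<Rightarrow> bool" where
  "gateaux_smooth X \<longleftrightarrow>
     (\<forall>x\<in>unit_sphere X. \<forall>y\<in>vcarrier X. \<exists>L.
        ((\<lambda>t::real. (vnorm X (vadd X x (vscale X (of_real t) y)) - vnorm X x) / t) \<longlongrightarrow> L) (at 0))"

definition linear_subspace :: "'v set \<Rightarrow> ('k, 'v) nspace \<Rightarrow> bool" where
  "linear_subspace Y X \<longleftrightarrow>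
     Y \<subseteq> vcarrier X \<and> Y \<noteq> {} \<and>
     (\<forall>x\<in>Y. \<forall>y\<in>Y. vadd X x y \<in> Y) \<and> (\<forall>c. \<forall>x\<in>Y. vscale X c x \<in> Y)"

definition linearly_isometric :: "('k, 'v) nspace \<Rightarrow> ('k, 'w) nspace \<Rightarrow> bool" where
  "linearly_isometric X Y \<longleftrightarrow>
     (\<exists>\<phi>. bij_betw \<phi> (vcarrier X) (vcarrier Y) \<and>
        (\<forall>x\<in>vcarrier X. \<forall>y\<in>vcarrier X. \<phi> (vadd X x y) = vadd Y (\<phi> x) (\<phi> y)) \<and>
        (\<forall>c. \<forall>x\<in>vcarrier X. \<phi> (vscale X c x) = vscale Y c (\<phi> x)) \<and>
        (\<forall>x\<in>vcarrier X. vnorm Y (\<phi> x) = vnorm X x))"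

definition contains_isometric_copy :: "('k, 'v) nspace \<Rightarrow> ('k, 'w) nspace \<Rightarrow> bool" where
  "contains_isometric_copy X E \<longleftrightarrow>
     (\<exists>Y. linear_subspace Y X \<and> linearly_isometric (X\<lparr>vcarrier := Y\<rparr>) E)"

definition ell1_2 :: "('k::real_normed_field, 'k \<times> 'k) nspace" where
  "ell1_2 = \<lparr>vcarrier = UNIV,
             vadd = (\<lambda>(\<alpha>, \<beta>) (\<gamma>, \<delta>). (\<alpha> + \<gamma>, \<beta> + \<delta>)),
             vscale = (\<lambda>c (\<alpha>, \<beta>). (c * \<alpha>, c * \<beta>)),
             vnorm = (\<lambda>(\<alpha>, \<beta>). norm \<alpha> + norm \<beta>)\<rparr>"

definition invertible_mpt :: "'a measure \<Rightarrow> ('a \<Rightarrow> 'a) \<Rightarrow> bool" where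
  "invertible_mpt M T \<longleftrightarrow>
     bij_betw T (space M) (space M) \<and>
     T \<in> measurable M M \<and> inv_into (space M) T \<in> measurable M M \<and>
     (\<forall>A\<in>sets M. emeasure M (T -` A \<inter> space M) = emeasure M A)"

definition ergodic :: "'a measure \<Rightarrow> ('a \<Rightarrow> 'a) \<Rightarrow> bool" where
  "ergodic M T \<longleftrightarrow>
     (\<forall>A\<in>sets M. measure M (sym_diff A (T -` A \<inter> space M)) = 0 \<longrightarrow>
        measure M A = 0 \<or> measure M A = 1)"

definition iter_int :: "'a measure \<Rightarrow> ('a \<Rightarrow> 'a) \<Rightarrow> int \<Rightarrow> 'a \<Rightarrow> 'a" where
  "iter_int M T k = (if 0 \<le> k then T ^^ nat k else inv_into (space M) T ^^ nat (- k))"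

text \<open>
  Vectors are classes of integrable functions modulo equality almost everywhere.  The functions
  are defined on the whole type, but \<open>ae_rel M\<close> ignores their values outside \<open>space M\<close>.
\<close>

definition ae_rel ::
  "'a measure \<Rightarrow> (('a \<Rightarrow> 'k::{real_normed_field,banach,second_countable_topology}) \<times> ('a \<Rightarrow> 'k)) set" where
  "ae_rel M = {(f, g). integrable M f \<and> integrable M g \<and> (AE \<omega> in M. f \<omega> = g \<omega>)}"

text \<open>
  For integrable \<open>f\<close> the inner series converges almost everywhere; on the exceptional null set
  the infinite sum is \<open>0\<close> by convention, which does not affect the integral.
\<close>

definition orbit_norm_fun ::
  "'a measure \<Rightarrow> ('a \<Rightarrow> 'a) \<Rightarrow> (int \<Rightarrow> real) \<Rightarrow> ('a \<Rightarrow> 'k::real_normed_field) \<Rightarrow> real" where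
  "orbit_norm_fun M T a f =
     (\<integral>\<omega>. sqrt (\<Sum>\<^sub>\<infinity>k\<in>UNIV. a k * (norm (f (iter_int M T k \<omega>)))\<^sup>2) \<partial>M)"

text \<open>
  The operations below are independent of representatives, so the union of the classes of all
  sums (multiples) is a single class, and the norm takes a single value on each class.
\<close>

definition L1_orbit ::
  "'a measure \<Rightarrow> ('a \<Rightarrow> 'a) \<Rightarrow> (int \<Rightarrow> real) \<Rightarrow>
     ('k::{real_normed_field,banach,second_countable_topology}, ('a \<Rightarrow> 'k) set) nspace" where
  "L1_orbit M T a =
     \<lparr>vcarrier = {f. integrable M f} // ae_rel M,
      vadd = (\<lambda>F G. \<Union>f\<in>F. \<Union>g\<in>G. ae_rel M `` {\<lambda>\<omega>. f \<omega> + g \<omega>}),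
      vscale = (\<lambda>c F. \<Union>f\<in>F. ae_rel M `` {\<lambda>\<omega>. c * f \<omega>}),
      vnorm = (\<lambda>F. the_elem (orbit_norm_fun M T a ` F))\<rparr>"

end

theory Submission
  imports Defs
begin

text \<open>
  Write \<open>N\<^sub>f(\<omega>)\<close> for the weighted \<open>\<ell>\<^sub>2\<close> norm of the orbit sequence \<open>(f(T\<^sup>k \<omega>))\<^sub>k\<close>, so that the norm
  of \<open>f\<close> in \<open>X\<close> is the integral of \<open>N\<^sub>f\<close>.  A weighted \<open>\<ell>\<^sub>2\<close> norm is strictly convex, and it is
  differentiable away from zero.  Integration preserves these properties as soon as \<open>N\<^sub>f\<close> is nonzero
  almost everywhere and the factors between proportional orbit sequences do not vary from point to
  point; ergodicity gives both.

  Let \<open>T\<close> be ergodic.  For \<open>f \<noteq> 0\<close> the set \<open>{N\<^sub>f = 0}\<close> is invariant and not of full measure, hence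
  null (\<open>AE_wnorm_orbit_pos\<close>).  Dominated convergence then turns the pointwise derivatives into a
  derivative of the norm (\<open>orbit_norm_directional_derivative\<close>), which is Gateaux smoothness.  For
  strict convexity, let \<open>f\<close> and \<open>g\<close> be unit vectors with a midpoint of norm one.  Equality in the
  triangle inequality holds at almost every point, so the two orbit sequences are proportional there;
  the ratio \<open>N\<^sub>g / N\<^sub>f\<close> is the same along an orbit, and the zero-one law for \<open>{N\<^sub>f < N\<^sub>g}\<close> together with
  equal integrals gives \<open>N\<^sub>f = N\<^sub>g\<close> and hence \<open>f = g\<close> (\<open>orbit_norm_strict_triangle\<close>).

  Conversely, strict convexity and smoothness are inherited by subspaces and fail in \<open>\<ell>\<^sub>1\<^sup>2\<close>, so each
  of them excludes a copy of \<open>\<ell>\<^sub>1\<^sup>2\<close>.  If \<open>T\<close> is not ergodic, an invariant set of intermediate measure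
  and its complement carry normalized indicators that span such a copy
  (\<open>not_ergodic_imp_ell1_2\<close>).
\<close>

section \<open>Weighted square-summable sequences\<close>

definition wsq_summable :: "('i \<Rightarrow> real) \<Rightarrow> ('i \<Rightarrow> 'k::real_normed_vector) \<Rightarrow> bool" where
  "wsq_summable a x \<longleftrightarrow> (\<lambda>k. a k * (norm (x k))\<^sup>2) summable_on UNIV"

definition wnorm :: "('i \<Rightarrow> real) \<Rightarrow> ('i \<Rightarrow> 'k::real_normed_vector) \<Rightarrow> real" where
  "wnorm a x = sqrt (\<Sum>\<^sub>\<infinity>k\<in>UNIV. a k * (norm (x k))\<^sup>2)"

definition winner :: "('i \<Rightarrow> real) \<Rightarrow> ('i \<Rightarrow> 'k::real_inner) \<Rightarrow> ('i \<Rightarrow> 'k) \<Rightarrow> real" where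
  "winner a x y = (\<Sum>\<^sub>\<infinity>k\<in>UNIV. a k * (x k \<bullet> y k))"

lemma wnorm_norm_cong: "(\<And>k. norm (x k) = norm (y k)) \<Longrightarrow> wnorm a x = wnorm a y"
  by (simp add: wnorm_def)

locale positive_weights =
  fixes a :: "'i \<Rightarrow> real"
  assumes a_pos: "\<And>k. a k > 0"
begin

lemma wnorm_nonneg: "wnorm a x \<ge> 0"
  unfolding wnorm_def by (intro real_sqrt_ge_zero infsum_nonneg) (simp add: less_imp_le[OF a_pos])

lemma has_sum_wnorm_sq:
  assumes "wsq_summable a x"
  shows "((\<lambda>k. a k * (norm (x k))\<^sup>2) has_sum (wnorm a x)\<^sup>2) UNIV"
proof -
  have "0 \<le> (\<Sum>\<^sub>\<infinity>k\<in>UNIV. a k * (norm (x k))\<^sup>2)"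
    by (intro infsum_nonneg) (simp add: less_imp_le[OF a_pos])
  then show ?thesis
    using assms by (simp add: wsq_summable_def wnorm_def)
qed

lemma has_sum_winner:
  assumes "wsq_summable a x" "wsq_summable a y"
  shows "((\<lambda>k. a k * (x k \<bullet> y k)) has_sum winner a x y) UNIV"
proof -
  have "(\<lambda>k. norm (a k * (x k \<bullet> y k))) summable_on UNIV"
  proof (rule summable_on_comparison_test)
    show "(\<lambda>k. a k * (norm (x k))\<^sup>2 + a k * (norm (y k))\<^sup>2) summable_on UNIV"
      using assms by (intro summable_on_add) (simp_all add: wsq_summable_def)
    fix k
    have "\<bar>x k \<bullet> y k\<bar> \<le> norm (x k) * norm (y k)"
      by (rule Cauchy_Schwarz_ineq2)
    also have "\<dots> \<le> (norm (x k))\<^sup>2 + (norm (y k))\<^sup>2"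
    proof -
      have "0 \<le> norm (x k) * norm (y k)" by simp
      then show ?thesis
        using sum_squares_bound[of "norm (x k)" "norm (y k)"] by linarith
    qed
    finally have "a k * \<bar>x k \<bullet> y k\<bar> \<le> a k * ((norm (x k))\<^sup>2 + (norm (y k))\<^sup>2)"
      by (intro mult_left_mono less_imp_le[OF a_pos])
    then show "norm (a k * (x k \<bullet> y k)) \<le> a k * (norm (x k))\<^sup>2 + a k * (norm (y k))\<^sup>2"
      using a_pos[of k] by (simp add: abs_mult distrib_left)
  qed simp_all
  then show ?thesis
    unfolding winner_def by (rule has_sum_infsum[OF abs_summable_summable])
qed

lemma
  assumes "wsq_summable a x" "wsq_summable a y"
  shows wsq_summable_lincomb: "wsq_summable a (\<lambda>k. s *\<^sub>R x k + t *\<^sub>R y k)" (is ?A)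
    and wnorm_lincomb_sq: "(wnorm a (\<lambda>k. s *\<^sub>R x k + t *\<^sub>R y k))\<^sup>2
       = s\<^sup>2 * (wnorm a x)\<^sup>2 + 2 * s * t * winner a x y + t\<^sup>2 * (wnorm a y)\<^sup>2" (is "?l = ?r")
proof -
  have "((\<lambda>k. s\<^sup>2 * (a k * (norm (x k))\<^sup>2) + (2 * s * t) * (a k * (x k \<bullet> y k))
           + t\<^sup>2 * (a k * (norm (y k))\<^sup>2)) has_sum ?r) UNIV"
    by (intro has_sum_add has_sum_cmult_right has_sum_wnorm_sq has_sum_winner assms)
  also have "(\<lambda>k. s\<^sup>2 * (a k * (norm (x k))\<^sup>2) + (2 * s * t) * (a k * (x k \<bullet> y k))
           + t\<^sup>2 * (a k * (norm (y k))\<^sup>2)) = (\<lambda>k. a k * (norm (s *\<^sub>R x k + t *\<^sub>R y k))\<^sup>2)"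
  proof
    fix k
    have "(norm (s *\<^sub>R x k + t *\<^sub>R y k))\<^sup>2
        = s\<^sup>2 * (norm (x k))\<^sup>2 + 2 * s * t * (x k \<bullet> y k) + t\<^sup>2 * (norm (y k))\<^sup>2"
      unfolding power2_norm_eq_inner
      by (simp add: inner_add_left inner_add_right inner_commute[of "y k" "x k"] power2_eq_square algebra_simps)
    then show "s\<^sup>2 * (a k * (norm (x k))\<^sup>2) + (2 * s * t) * (a k * (x k \<bullet> y k))
           + t\<^sup>2 * (a k * (norm (y k))\<^sup>2) = a k * (norm (s *\<^sub>R x k + t *\<^sub>R y k))\<^sup>2"
      by (simp only: distrib_left mult_ac)
  qed
  finally have h: "((\<lambda>k. a k * (norm (s *\<^sub>R x k + t *\<^sub>R y k))\<^sup>2) has_sum ?r) UNIV" .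
  then show A: ?A
    by (auto simp: wsq_summable_def summable_on_def)
  show "?l = ?r"
    using has_sum_unique[OF has_sum_wnorm_sq[OF A] h] .
qed

text \<open>
  This is where strict positivity of every weight enters: with a zero weight the expression
  would only be a seminorm.
\<close>

lemma wnorm_eq_0D:
  assumes "wsq_summable a x" "wnorm a x = 0"
  shows "x k = 0"
proof -
  have "a k * (norm (x k))\<^sup>2 = 0"
  proof (rule nonneg_infsum_le_0D[where A = UNIV and f = "\<lambda>k. a k * (norm (x k))\<^sup>2"])
    show "(\<lambda>k. a k * (norm (x k))\<^sup>2) summable_on UNIV" using assms by (simp add: wsq_summable_def)
    show "(\<Sum>\<^sub>\<infinity>k\<in>UNIV. a k * (norm (x k))\<^sup>2) \<le> 0" using assms by (simp add: wnorm_def)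
  qed (simp_all add: less_imp_le[OF a_pos])
  then show ?thesis using a_pos[of k] by simp
qed

text \<open>
  The weighted sum of squares of \<open>\<parallel>y\<parallel> x - \<parallel>x\<parallel> y\<close> equals
  \<open>2\<parallel>x\<parallel>\<parallel>y\<parallel> (\<parallel>x\<parallel>\<parallel>y\<parallel> - \<langle>x, y\<rangle>)\<close>.  For nonzero \<open>x\<close> and \<open>y\<close>, its
  nonnegativity is the Cauchy-Schwarz inequality.
\<close>

lemma winner_cauchy_schwarz:
  assumes "wsq_summable a x" "wsq_summable a y"
  shows "winner a x y \<le> wnorm a x * wnorm a y"
proof (cases "wnorm a x = 0 \<or> wnorm a y = 0")
  case True
  then have "\<And>k. a k * (x k \<bullet> y k) = 0"
    using wnorm_eq_0D[OF assms(1)] wnorm_eq_0D[OF assms(2)] by auto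
  then have "winner a x y = 0" unfolding winner_def by (intro infsum_0)
  then show ?thesis using wnorm_nonneg[of x] wnorm_nonneg[of y] by simp
next
  case False
  then have p: "0 < wnorm a x * wnorm a y"
    using wnorm_nonneg[of x] wnorm_nonneg[of y] by (simp add: less_le)
  have "0 \<le> (wnorm a (\<lambda>k. wnorm a y *\<^sub>R x k + (- wnorm a x) *\<^sub>R y k))\<^sup>2" by simp
  also have "\<dots> = 2 * (wnorm a x * wnorm a y) * (wnorm a x * wnorm a y - winner a x y)"
    unfolding wnorm_lincomb_sq[OF assms] by (simp add: power2_eq_square algebra_simps)
  finally show ?thesis using p by (simp add: zero_le_mult_iff)
qed

lemma wnorm_triangle:
  fixes x y :: "'i \<Rightarrow> 'k::real_inner"
  assumes "wsq_summable a x" "wsq_summable a y"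
  shows "wnorm a (\<lambda>k. x k + y k) \<le> wnorm a x + wnorm a y"
proof (rule power2_le_imp_le)
  show "(wnorm a (\<lambda>k. x k + y k))\<^sup>2 \<le> (wnorm a x + wnorm a y)\<^sup>2"
    using wnorm_lincomb_sq[OF assms, of 1 1] winner_cauchy_schwarz[OF assms]
    by (simp add: power2_sum)
qed (simp add: wnorm_nonneg)

text \<open>
  The identity behind the Cauchy-Schwarz inequality shows that \<open>\<parallel>y\<parallel> x - \<parallel>x\<parallel> y\<close> has norm zero.
\<close>

lemma wnorm_triangle_eqD:
  fixes x y :: "'i \<Rightarrow> 'k::real_inner"
  assumes "wsq_summable a x" "wsq_summable a y"
    and "wnorm a (\<lambda>k. x k + y k) = wnorm a x + wnorm a y"
  shows "wnorm a y *\<^sub>R x k = wnorm a x *\<^sub>R y k"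
proof -
  let ?d = "\<lambda>k. wnorm a y *\<^sub>R x k + (- wnorm a x) *\<^sub>R y k"
  have "winner a x y = wnorm a x * wnorm a y"
    using wnorm_lincomb_sq[OF assms(1,2), of 1 1] assms(3) by (simp add: power2_sum)
  then have "(wnorm a ?d)\<^sup>2 = 0"
    unfolding wnorm_lincomb_sq[OF assms(1,2)] by (simp add: power2_eq_square algebra_simps)
  then have "?d k = 0"
    by (intro wnorm_eq_0D[of ?d] wsq_summable_lincomb assms) simp
  then show ?thesis by simp
qed

lemma wnorm_scaleR: "wnorm a (\<lambda>k. c *\<^sub>R x k) = \<bar>c\<bar> * wnorm a x"
proof -
  have "(\<lambda>k. a k * (norm (c *\<^sub>R x k))\<^sup>2) = (\<lambda>k. c\<^sup>2 * (a k * (norm (x k))\<^sup>2))"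
    by (simp add: power_mult_distrib mult_ac)
  then show ?thesis
    by (simp only: wnorm_def infsum_cmult_right' real_sqrt_mult real_sqrt_abs)
qed

lemma wsq_summable_scaleR:
  fixes x :: "'i \<Rightarrow> 'k::real_inner"
  shows "wsq_summable a x \<Longrightarrow> wsq_summable a (\<lambda>k. c *\<^sub>R x k)"
  using wsq_summable_lincomb[of x x c 0] by simp

text \<open>
  The bound does not depend on \<open>x\<close> and is linear in \<open>t\<close>, so it dominates all difference
  quotients of the norm at once.
\<close>

lemma wnorm_difference_bound:
  fixes x y :: "'i \<Rightarrow> 'k::real_inner"
  assumes "wsq_summable a x" "wsq_summable a y"
  shows "\<bar>wnorm a (\<lambda>k. x k + t *\<^sub>R y k) - wnorm a x\<bar> \<le> \<bar>t\<bar> * wnorm a y"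
proof -
  have xy: "wsq_summable a (\<lambda>k. x k + t *\<^sub>R y k)"
    using wsq_summable_lincomb[OF assms, of 1 t] by simp
  have "wnorm a (\<lambda>k. x k + t *\<^sub>R y k) \<le> wnorm a x + \<bar>t\<bar> * wnorm a y"
    using wnorm_triangle[OF assms(1) wsq_summable_scaleR[OF assms(2)], of t] 
    by (simp add: wnorm_scaleR)
  moreover have "wnorm a x \<le> wnorm a (\<lambda>k. x k + t *\<^sub>R y k) + \<bar>t\<bar> * wnorm a y"
    using wnorm_triangle[OF xy wsq_summable_scaleR[OF assms(2), of "- t"]]
      wnorm_scaleR[of "- t" y] by simp
  ultimately show ?thesis by linarith
qed

lemma wnorm_has_directional_derivative:
  assumes "wsq_summable a x" "wsq_summable a y" "wnorm a x > 0"
  shows "((\<lambda>t. (wnorm a (\<lambda>k. x k + t *\<^sub>R y k) - wnorm a x) / t) \<longlongrightarrow> winner a x y / wnorm a x) (at 0)"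
proof -
  have eq: "wnorm a (\<lambda>k. x k + t *\<^sub>R y k)
      = sqrt ((wnorm a x)\<^sup>2 + 2 * t * winner a x y + t\<^sup>2 * (wnorm a y)\<^sup>2)" for t
    using wnorm_lincomb_sq[OF assms(1,2), of 1 t] wnorm_nonneg[of "\<lambda>k. x k + t *\<^sub>R y k"]
    by (simp add: real_sqrt_unique)
  have "((\<lambda>t. wnorm a (\<lambda>k. x k + t *\<^sub>R y k)) has_real_derivative winner a x y / wnorm a x) (at 0)"
    unfolding eq using assms(3) by (auto intro!: derivative_eq_intros simp: field_simps)
  then show ?thesis
    by (simp add: has_field_derivative_iff)
qed

text \<open>
  The norm of \<open>\<ell>\<^sub>2\<close> is at most that of \<open>\<ell>\<^sub>1\<close>, applied to the sequence \<open>\<surd>a\<^sub>k \<bar>x\<^sub>k\<bar>\<close>.  The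
  \<open>\<ell>\<^sub>1\<close> expression is additive, so along orbits it can be integrated term by term.
\<close>

lemma wsq_summable_of_abs_summable:
  assumes s: "(\<lambda>k. sqrt (a k) * norm (x k)) summable_on UNIV"
  shows "wsq_summable a x"
    and "wnorm a x \<le> (\<Sum>\<^sub>\<infinity>k\<in>UNIV. sqrt (a k) * norm (x k))"
proof -
  define h where "h = (\<lambda>k. sqrt (a k) * norm (x k))"
  define S where "S = infsum h UNIV"
  have h0: "h k \<ge> 0" for k by (simp add: h_def less_imp_le[OF a_pos])
  have hs: "h summable_on UNIV" using s by (simp add: h_def)
  have hS: "h k \<le> S" for k
    using finite_sum_le_infsum[OF hs, of "{k}"] h0 by (simp add: S_def)
  have eq: "a k * (norm (x k))\<^sup>2 = (h k)\<^sup>2" for k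
    using a_pos[of k] by (simp add: h_def power_mult_distrib)
  have le: "(h k)\<^sup>2 \<le> S * h k" for k
    using mult_right_mono[OF hS h0] by (simp add: power2_eq_square)
  have Ss: "(\<lambda>k. S * h k) summable_on UNIV" by (intro summable_on_cmult_right hs)
  have q: "(\<lambda>k. (h k)\<^sup>2) summable_on UNIV"
    by (rule summable_on_comparison_test[OF Ss le]) simp_all
  then show "wsq_summable a x" by (simp add: wsq_summable_def eq)
  have "(\<Sum>\<^sub>\<infinity>k. (h k)\<^sup>2) \<le> (\<Sum>\<^sub>\<infinity>k. S * h k)"
    by (intro infsum_mono q Ss le)
  also have "\<dots> = S\<^sup>2" by (simp add: infsum_cmult_right' S_def power2_eq_square)
  finally have "sqrt (\<Sum>\<^sub>\<infinity>k. (h k)\<^sup>2) \<le> S"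
    using real_le_lsqrt[of S] infsum_nonneg[of UNIV h] h0 by (simp add: S_def real_le_lsqrt)
  then show "wnorm a x \<le> (\<Sum>\<^sub>\<infinity>k\<in>UNIV. sqrt (a k) * norm (x k))"
    by (simp add: wnorm_def eq S_def h_def)
qed

end

section \<open>Iterates of an invertible measure-preserving map\<close>

locale invertible_system = prob_space M for M :: "'a measure" +
  fixes T :: "'a \<Rightarrow> 'a"
  assumes invertible: "invertible_mpt M T"
begin

abbreviation "iter \<equiv> iter_int M T"
abbreviation "Tinv \<equiv> inv_into (space M) T"

lemma bij_T: "bij_betw T (space M) (space M)"
  using invertible by (simp add: invertible_mpt_def)

lemma measurable_T [measurable]: "T \<in> measurable M M"
  and measurable_Tinv [measurable]: "Tinv \<in> measurable M M"
  using invertible by (simp_all add: invertible_mpt_def)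

lemma Tinv_T: "\<omega> \<in> space M \<Longrightarrow> Tinv (T \<omega>) = \<omega>"
  and T_Tinv: "\<omega> \<in> space M \<Longrightarrow> T (Tinv \<omega>) = \<omega>"
  using bij_T by (simp_all add: bij_betw_inv_into_left bij_betw_inv_into_right)

lemma distr_T: "distr M M T = M"
  using invertible by (intro measure_eqI) (auto simp: emeasure_distr invertible_mpt_def)

lemma distr_Tinv: "distr M M Tinv = M"
proof (rule measure_eqI)
  fix A assume "A \<in> sets (distr M M Tinv)"
  then have A [measurable]: "A \<in> sets M" by simp
  have "T -` (Tinv -` A \<inter> space M) \<inter> space M = A"
    using sets.sets_into_space[OF A] measurable_space[OF measurable_T] by (auto simp: Tinv_T)
  then have "emeasure M (Tinv -` A \<inter> space M) = emeasure M A"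
    using invertible by (metis A invertible_mpt_def measurable_Tinv measurable_sets)
  then show "emeasure (distr M M Tinv) A = emeasure M A"
    by (simp add: emeasure_distr)
qed simp

lemma measurable_funpow:
  "S \<in> measurable M M \<Longrightarrow> S ^^ n \<in> measurable M M"
  by (induction n) (auto simp: id_def intro: measurable_comp)

lemma distr_funpow:
  assumes S: "S \<in> measurable M M" "distr M M S = M"
  shows "distr M M (S ^^ n) = M"
proof (induction n)
  case (Suc n)
  have "distr M M (S ^^ Suc n) = distr (distr M M (S ^^ n)) M S"
    by (simp add: distr_distr S measurable_funpow)
  also have "\<dots> = M" by (simp only: Suc S)
  finally show ?case .
qed (simp add: id_def distr_id)

lemma measurable_iter [measurable]: "iter k \<in> measurable M M"
  by (simp add: iter_int_def measurable_funpow)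

lemma distr_iter: "distr M M (iter k) = M"
  by (simp add: iter_int_def distr_funpow distr_T distr_Tinv)

lemma iter_0: "iter 0 = id"
  by (simp add: iter_int_def)

lemma funpow_space: "S \<in> measurable M M \<Longrightarrow> \<omega> \<in> space M \<Longrightarrow> (S ^^ n) \<omega> \<in> space M"
  using measurable_space[OF measurable_funpow] .

lemma iter_T:
  assumes "\<omega> \<in> space M"
  shows "iter k (T \<omega>) = iter (k + 1) \<omega>" and "T (iter k \<omega>) = iter (k + 1) \<omega>"
proof -
  have "iter k (T \<omega>) = iter (k + 1) \<omega> \<and> T (iter k \<omega>) = iter (k + 1) \<omega>"
  proof (cases "0 \<le> k")
    case True
    then have "nat (k + 1) = Suc (nat k)" by simp
    with True show ?thesis
      by (simp add: iter_int_def funpow_swap1)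
  next
    case False
    define n where "n = nat (- (k + 1))"
    have k: "k = - int (Suc n)" using False by (simp add: n_def)
    have "iter (k + 1) \<omega> = (Tinv ^^ n) \<omega>"
      by (cases n) (simp_all add: iter_int_def k nat_add_distrib)
    moreover have "iter k (T \<omega>) = (Tinv ^^ n) \<omega>"
      using assms by (simp add: iter_int_def k Tinv_T nat_add_distrib funpow_swap1)
    moreover have "T (iter k \<omega>) = (Tinv ^^ n) \<omega>"
      using funpow_space[OF measurable_Tinv assms, of n]
      by (simp add: iter_int_def k T_Tinv nat_add_distrib)
    ultimately show ?thesis by simp
  qed
  then show "iter k (T \<omega>) = iter (k + 1) \<omega>" "T (iter k \<omega>) = iter (k + 1) \<omega>" by simp_all
qed

lemma AE_iter:
  assumes "AE \<omega> in M. P \<omega>"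
  shows "AE \<omega> in M. P (iter k \<omega>)"
  by (rule AE_distrD[OF measurable_iter]) (use assms in \<open>simp only: distr_iter\<close>)

lemma AE_all_iter:
  assumes "AE \<omega> in M. P \<omega>"
  shows "AE \<omega> in M. \<forall>k. P (iter k \<omega>)"
  using AE_iter[OF assms] by (simp add: AE_all_countable)

lemma AE_T:
  assumes "AE \<omega> in M. P \<omega>"
  shows "AE \<omega> in M. P (T \<omega>)"
  by (rule AE_distrD[OF measurable_T]) (use assms in \<open>simp only: distr_T\<close>)

lemma integrable_iter:
  fixes f :: "'a \<Rightarrow> 'k::{banach, second_countable_topology}"
  assumes f: "integrable M f"
  shows "integrable M (\<lambda>\<omega>. f (iter k \<omega>))"
    and "(\<integral>\<omega>. f (iter k \<omega>) \<partial>M) = (\<integral>\<omega>. f \<omega> \<partial>M)"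
proof -
  show "integrable M (\<lambda>\<omega>. f (iter k \<omega>))"
    using integrable_distr[OF measurable_iter, of k f] f by (simp add: distr_iter)
  show "(\<integral>\<omega>. f (iter k \<omega>) \<partial>M) = (\<integral>\<omega>. f \<omega> \<partial>M)"
    using integral_distr[OF measurable_iter borel_measurable_integrable[OF f], of k]
    by (simp add: distr_iter)
qed

text \<open>
  Ergodicity is defined through sets that are invariant up to a null set; the arguments below
  produce predicates that are invariant almost everywhere.
\<close>

lemma measure_sym_diff_zero_iff:
  assumes [measurable]: "A \<in> sets M"
  shows "measure M (sym_diff A (T -` A \<inter> space M)) = 0 \<longleftrightarrow> (AE \<omega> in M. T \<omega> \<in> A \<longleftrightarrow> \<omega> \<in> A)"
proof -
  have s: "sym_diff A (T -` A \<inter> space M) = {\<omega> \<in> space M. \<not> (T \<omega> \<in> A \<longleftrightarrow> \<omega> \<in> A)}"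
    using sets.sets_into_space[OF assms] by auto
  have "{\<omega> \<in> space M. \<not> (T \<omega> \<in> A \<longleftrightarrow> \<omega> \<in> A)} \<in> sets M" by measurable
  then show ?thesis
    unfolding s by (subst AE_iff_measurable[OF _ refl]) (simp_all add: emeasure_eq_measure)
qed

lemma ergodicD:
  assumes "ergodic M T" and [measurable]: "Measurable.pred M P"
    and inv: "AE \<omega> in M. P (T \<omega>) \<longleftrightarrow> P \<omega>"
  shows "(AE \<omega> in M. P \<omega>) \<or> (AE \<omega> in M. \<not> P \<omega>)"
proof -
  let ?A = "{\<omega> \<in> space M. P \<omega>}"
  have A: "?A \<in> sets M" by measurable
  have "AE \<omega> in M. T \<omega> \<in> ?A \<longleftrightarrow> \<omega> \<in> ?A"
    using inv AE_space by eventually_elim (auto simp: measurable_space[OF measurable_T])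
  then have "prob ?A = 0 \<or> prob ?A = 1"
    using assms(1) A measure_sym_diff_zero_iff[OF A] unfolding ergodic_def by blast
  then show ?thesis
  proof
    assume "prob ?A = 0"
    then have "AE \<omega> in M. \<not> P \<omega>"
      by (subst AE_iff_measurable[of ?A]) (auto simp: emeasure_eq_measure)
    then show ?thesis ..
  next
    assume "prob ?A = 1"
    then have "AE \<omega> in M. P \<omega>" by (simp add: prob_Collect_eq_1)
    then show ?thesis ..
  qed
qed

end

section \<open>The orbit norm\<close>

text \<open>
  Viewing a sum over the integers as an integral for the counting measure makes the measurability
  and Fubini theorems for product measures available.
\<close>

lemma integrable_count_space_iff_summable_on:
  "integrable (count_space UNIV) (f :: 'i \<Rightarrow> real) \<longleftrightarrow> f summable_on UNIV"
  unfolding Infinite_Set_Sum.abs_summable_on_def[symmetric] abs_summable_equivalent[symmetric]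
  by (rule summable_on_iff_abs_summable_on_real[symmetric])

lemma infsum_eq_integral_count_space:
  fixes f :: "'i \<Rightarrow> real"
  shows "(\<Sum>\<^sub>\<infinity>k. f k) = (\<integral>k. f k \<partial>count_space UNIV)"
proof (cases "f summable_on UNIV")
  case True
  then have "Infinite_Set_Sum.abs_summable_on f UNIV"
    by (simp add: Infinite_Set_Sum.abs_summable_on_def integrable_count_space_iff_summable_on)
  then show ?thesis
    using infsetsum_infsum[of f UNIV] by (simp add: infsetsum_def)
next
  \<comment> \<open>Both sides are \<open>0\<close> by convention.\<close>
  case False
  then show ?thesis
    by (simp add: infsum_not_exists not_integrable_integral_eq integrable_count_space_iff_summable_on)
qed

locale weighted_system = invertible_system M T + positive_weights a
  for M :: "'a measure" and T and a :: "int \<Rightarrow> real" +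
  assumes a_sum: "(a has_sum 1) UNIV"
    and sqrt_a: "(\<lambda>k. sqrt (a k)) summable_on UNIV"
begin

abbreviation orbit :: "('a \<Rightarrow> 'k) \<Rightarrow> 'a \<Rightarrow> int \<Rightarrow> 'k" where
  "orbit f \<omega> \<equiv> \<lambda>k. f (iter k \<omega>)"

abbreviation orbit_norm :: "('a \<Rightarrow> 'k::real_normed_field) \<Rightarrow> real" where
  "orbit_norm \<equiv> orbit_norm_fun M T a"

lemma orbit_norm_eq: "orbit_norm f = (\<integral>\<omega>. wnorm a (orbit f \<omega>) \<partial>M)"
  by (simp add: orbit_norm_fun_def wnorm_def)

lemma measurable_orbit_sum:
  fixes g :: "int \<Rightarrow> 'a \<Rightarrow> real"
  assumes [measurable]: "\<And>k. g k \<in> borel_measurable M"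
  shows "(\<lambda>\<omega>. \<Sum>\<^sub>\<infinity>k. g k \<omega>) \<in> borel_measurable M"
proof -
  interpret C: sigma_finite_measure "count_space (UNIV :: int set)"
    by (rule sigma_finite_measure_count_space)
  show ?thesis
    unfolding infsum_eq_integral_count_space
  proof (rule C.borel_measurable_lebesgue_integral)
    show "(\<lambda>(\<omega>, k). g k \<omega>) \<in> borel_measurable (M \<Otimes>\<^sub>M count_space UNIV)"
      unfolding case_prod_beta
      by (rule measurable_compose_countable'[where f = "\<lambda>k p. g k (fst p)" and I = UNIV]) simp_all
  qed
qed

lemma measurable_wnorm_orbit [measurable]:
  fixes f :: "'a \<Rightarrow> 'k::real_normed_vector"
  assumes f [measurable]: "f \<in> borel_measurable M"
  shows "(\<lambda>\<omega>. wnorm a (orbit f \<omega>)) \<in> borel_measurable M"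
proof -
  have [measurable]: "(\<lambda>\<omega>. \<Sum>\<^sub>\<infinity>k. a k * (norm (f (iter k \<omega>)))\<^sup>2) \<in> borel_measurable M"
    by (intro measurable_orbit_sum) measurable
  show ?thesis unfolding wnorm_def by measurable
qed

text \<open>
  Each iterate preserves the measure, so the integral of \<open>\<Sum>\<^sub>k \<surd>a\<^sub>k \<bar>f \<circ> T\<^sup>k\<bar>\<close> is
  \<open>(\<Sum>\<^sub>k \<surd>a\<^sub>k) \<parallel>f\<parallel>\<^sub>1\<close>, which is finite.  Hence this sum is finite almost everywhere, and it dominates
  the weighted \<open>\<ell>\<^sub>2\<close> norm of the orbit of \<open>f\<close>.
\<close>

lemma
  fixes f :: "'a \<Rightarrow> 'k::{real_normed_vector, banach, second_countable_topology}"
  assumes f: "integrable M f"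
  shows AE_wsq_summable_orbit: "AE \<omega> in M. wsq_summable a (orbit f \<omega>)"
    and integrable_wnorm_orbit: "integrable M (\<lambda>\<omega>. wnorm a (orbit f \<omega>))"
proof -
  let ?h = "\<lambda>k \<omega>. sqrt (a k) * norm (f (iter k \<omega>))"
  interpret C: sigma_finite_measure "count_space (UNIV :: int set)"
    by (rule sigma_finite_measure_count_space)
  interpret P: pair_sigma_finite "count_space (UNIV :: int set)" M ..
  note [measurable] = borel_measurable_integrable[OF f]
  have "integrable (count_space UNIV \<Otimes>\<^sub>M M) (\<lambda>(k, \<omega>). ?h k \<omega>)"
  proof (rule P.Fubini_integrable)
    show "(\<lambda>(k, \<omega>). ?h k \<omega>) \<in> borel_measurable (count_space UNIV \<Otimes>\<^sub>M M)"
      by (rule measurable_pair_measure_countable1) simp_all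
    have "(\<integral>\<omega>. norm (?h k \<omega>) \<partial>M) = sqrt (a k) * (\<integral>\<omega>. norm (f \<omega>) \<partial>M)" for k
      using integrable_iter(2)[OF integrable_norm[OF f], of k] by (simp add: less_imp_le[OF a_pos])
    then show "integrable (count_space UNIV) (\<lambda>k. \<integral>\<omega>. norm (case (k, \<omega>) of (k, \<omega>) \<Rightarrow> ?h k \<omega>) \<partial>M)"
      using sqrt_a by (simp add: integrable_count_space_iff_summable_on summable_on_cmult_left)
    show "AE k in count_space UNIV. integrable M (\<lambda>\<omega>. case (k, \<omega>) of (k, \<omega>) \<Rightarrow> ?h k \<omega>)"
      using integrable_iter(1)[OF integrable_norm[OF f]] by simp
  qed
  then have ae: "AE \<omega> in M. (\<lambda>k. ?h k \<omega>) summable_on UNIV"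
    and int: "integrable M (\<lambda>\<omega>. \<Sum>\<^sub>\<infinity>k. ?h k \<omega>)"
    using P.AE_integrable_snd[of ?h] P.integrable_snd[of ?h]
    by (simp_all add: integrable_count_space_iff_summable_on infsum_eq_integral_count_space)
  from ae show "AE \<omega> in M. wsq_summable a (orbit f \<omega>)"
    by eventually_elim (rule wsq_summable_of_abs_summable)
  show "integrable M (\<lambda>\<omega>. wnorm a (orbit f \<omega>))"
  proof (rule Bochner_Integration.integrable_bound[OF int])
    show "AE \<omega> in M. norm (wnorm a (orbit f \<omega>)) \<le> norm (\<Sum>\<^sub>\<infinity>k. ?h k \<omega>)"
      using ae
    proof eventually_elim
      case (elim \<omega>)
      from wsq_summable_of_abs_summable(2)[OF elim] wnorm_nonneg[of "orbit f \<omega>"]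
      show ?case by simp
    qed
  qed measurable
qed

lemma AE_orbit_cong:
  assumes "AE \<omega> in M. f \<omega> = g \<omega>"
  shows "AE \<omega> in M. orbit f \<omega> = orbit g \<omega>"
  using AE_all_iter[OF assms] by (simp add: fun_eq_iff)

lemma orbit_norm_cong:
  assumes "f \<in> borel_measurable M" "g \<in> borel_measurable M" "AE \<omega> in M. f \<omega> = g \<omega>"
  shows "orbit_norm f = orbit_norm g"
  unfolding orbit_norm_eq
  using AE_orbit_cong[OF assms(3)] assms(1,2)
  by (intro integral_cong_AE measurable_wnorm_orbit) auto

text \<open>
  The set of points whose whole orbit lies in the zero set of \<open>f\<close> is exactly invariant.  If \<open>T\<close>
  is ergodic, it has measure zero or one, and measure one would mean that \<open>f\<close> vanishes.
\<close>

lemma AE_wnorm_orbit_pos: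
  fixes f :: "'a \<Rightarrow> 'k::{real_normed_field, banach, second_countable_topology}"
  assumes erg: "ergodic M T" and f: "integrable M f" and nz: "orbit_norm f \<noteq> 0"
  shows "AE \<omega> in M. wnorm a (orbit f \<omega>) > 0"
proof -
  note [measurable] = borel_measurable_integrable[OF f]
  let ?Z = "\<lambda>\<omega>. \<forall>k. f (iter k \<omega>) = 0"
  have "AE \<omega> in M. ?Z (T \<omega>) \<longleftrightarrow> ?Z \<omega>"
  proof (rule AE_I2)
    fix \<omega> assume "\<omega> \<in> space M"
    then have "?Z (T \<omega>) \<longleftrightarrow> (\<forall>k. f (iter (k + 1) \<omega>) = 0)" by (simp add: iter_T)
    also have "\<dots> \<longleftrightarrow> ?Z \<omega>" by (metis diff_add_cancel)
    finally show "?Z (T \<omega>) \<longleftrightarrow> ?Z \<omega>" .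
  qed
  then consider "AE \<omega> in M. ?Z \<omega>" | "AE \<omega> in M. \<not> ?Z \<omega>"
    using ergodicD[OF erg, of ?Z] by auto
  then show ?thesis
  proof cases
    case 1
    then have "AE \<omega> in M. wnorm a (orbit f \<omega>) = 0"
      by eventually_elim (simp add: wnorm_def)
    then have "orbit_norm f = 0"
      unfolding orbit_norm_eq by (rule integral_eq_zero_AE)
    with nz show ?thesis by simp
  next
    case 2
    from 2 AE_wsq_summable_orbit[OF f] show ?thesis
    proof eventually_elim
      case (elim \<omega>)
      then have "wnorm a (orbit f \<omega>) \<noteq> 0" using wnorm_eq_0D by blast
      then show ?case using wnorm_nonneg[of "orbit f \<omega>"] by simp
    qed
  qed
qed

text \<open>
  Equality of the integrals forces equality in the pointwise triangle inequality, so the orbit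
  sequences of \<open>f\<close> and \<open>g\<close>, with norms \<open>N\<close> and \<open>N'\<close>, are proportional at almost every point.
  Moving along the orbit only shifts both sequences, so their ratio \<open>N'/N\<close> is an invariant function.  The set \<open>{N < N'}\<close>
  therefore has measure zero or one; as \<open>N\<close> and \<open>N'\<close> have the same integral it is null, and then
  \<open>N = N'\<close> almost everywhere.
\<close>

lemma orbit_norm_strict_triangle:
  fixes f g :: "'a \<Rightarrow> 'k::{real_normed_field, euclidean_space}"
  assumes erg: "ergodic M T"
    and f: "integrable M f" "orbit_norm f = 1" and g: "integrable M g" "orbit_norm g = 1"
    and eq: "orbit_norm (\<lambda>\<omega>. f \<omega> + g \<omega>) \<ge> 2"
  shows "AE \<omega> in M. f \<omega> = g \<omega>"
proof -
  note [measurable] = borel_measurable_integrable[OF f(1)] borel_measurable_integrable[OF g(1)]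
  let ?x = "orbit f" and ?y = "orbit g"
  let ?N = "\<lambda>\<omega>. wnorm a (?x \<omega>)" and ?N' = "\<lambda>\<omega>. wnorm a (?y \<omega>)"
  let ?S = "\<lambda>\<omega>. wnorm a (\<lambda>k. ?x \<omega> k + ?y \<omega> k)"
  note intN = integrable_wnorm_orbit[OF f(1)] and intN' = integrable_wnorm_orbit[OF g(1)]
  have intS: "integrable M ?S"
    using integrable_wnorm_orbit[of "\<lambda>\<omega>. f \<omega> + g \<omega>"] f(1) g(1) by simp
  note sums = AE_wsq_summable_orbit[OF f(1)] AE_wsq_summable_orbit[OF g(1)]
  have tri: "AE \<omega> in M. 0 \<le> ?N \<omega> + ?N' \<omega> - ?S \<omega>"
    using sums by eventually_elim (simp add: wnorm_triangle)
  have "(\<integral>\<omega>. ?N \<omega> + ?N' \<omega> - ?S \<omega> \<partial>M) \<le> 0"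
    using f(2) g(2) eq intN intN' intS by (simp add: orbit_norm_eq)
  with integral_nonneg_AE[OF tri] have "AE \<omega> in M. ?N \<omega> + ?N' \<omega> - ?S \<omega> = 0"
    using integral_nonneg_eq_0_iff_AE[OF _ tri] intN intN' intS by simp
  from this sums have proportional: "AE \<omega> in M. \<forall>k. ?N' \<omega> *\<^sub>R ?x \<omega> k = ?N \<omega> *\<^sub>R ?y \<omega> k"
    by eventually_elim (intro allI wnorm_triangle_eqD, simp_all)
  have pos: "AE \<omega> in M. ?N \<omega> > 0" "AE \<omega> in M. ?N' \<omega> > 0"
    using AE_wnorm_orbit_pos[OF erg f(1)] AE_wnorm_orbit_pos[OF erg g(1)] f(2) g(2) by simp_all
  \<comment> \<open>At \<open>T \<omega>\<close> the shifted sequences are proportional with the factors taken at \<open>\<omega>\<close>.\<close>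
  have ratio: "AE \<omega> in M. ?N' \<omega> * ?N (T \<omega>) = ?N \<omega> * ?N' (T \<omega>)"
    using proportional AE_space
  proof eventually_elim
    case (elim \<omega>)
    then have "\<And>k. ?N' \<omega> *\<^sub>R ?x (T \<omega>) k = ?N \<omega> *\<^sub>R ?y (T \<omega>) k"
      by (simp add: iter_T)
    then have "wnorm a (\<lambda>k. ?N' \<omega> *\<^sub>R ?x (T \<omega>) k) = wnorm a (\<lambda>k. ?N \<omega> *\<^sub>R ?y (T \<omega>) k)"
      by simp
    then show ?case by (simp add: wnorm_scaleR wnorm_nonneg)
  qed
  have "AE \<omega> in M. ?N (T \<omega>) < ?N' (T \<omega>) \<longleftrightarrow> ?N \<omega> < ?N' \<omega>"
    using ratio pos pos[THEN AE_T]
  proof eventually_elim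
    case (elim \<omega>)
    then have "?N' (T \<omega>) / ?N (T \<omega>) = ?N' \<omega> / ?N \<omega>" by (simp add: field_simps)
    then have "1 < ?N' (T \<omega>) / ?N (T \<omega>) \<longleftrightarrow> 1 < ?N' \<omega> / ?N \<omega>" by simp
    with elim show ?case by simp
  qed
  then consider "AE \<omega> in M. ?N \<omega> < ?N' \<omega>" | "AE \<omega> in M. \<not> ?N \<omega> < ?N' \<omega>"
    using ergodicD[OF erg, of "\<lambda>\<omega>. ?N \<omega> < ?N' \<omega>"] by auto
  \<comment> \<open>In the first case the norms of \<open>f\<close> and \<open>g\<close> would differ.\<close>
  then have ge: "AE \<omega> in M. 0 \<le> ?N \<omega> - ?N' \<omega>"
  proof cases
    case 1
    then have "(\<integral>\<omega>. ?N \<omega> \<partial>M) < (\<integral>\<omega>. ?N' \<omega> \<partial>M)"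
      by (intro integral_less_AE_space intN intN') (auto simp: emeasure_space_1)
    then show ?thesis using f(2) g(2) by (simp add: orbit_norm_eq)
  next
    case 2
    then show ?thesis by eventually_elim simp
  qed
  have "(\<integral>\<omega>. ?N \<omega> - ?N' \<omega> \<partial>M) = 0"
    using f(2) g(2) intN intN' by (simp add: orbit_norm_eq)
  then have "AE \<omega> in M. ?N \<omega> - ?N' \<omega> = 0"
    using integral_nonneg_eq_0_iff_AE[OF _ ge] intN intN' by simp
  from this proportional pos(1) show ?thesis
  proof eventually_elim
    case (elim \<omega>)
    then have "?x \<omega> 0 = ?y \<omega> 0" by simp
    then show ?case by (simp add: iter_0)
  qed
qed

text \<open>
  Dominated convergence applied to the pointwise derivatives.  The norm of an orbit sequence is
  differentiable in every direction only where it is nonzero, which is why positivity almost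
  everywhere is assumed.
\<close>

lemma orbit_norm_directional_derivative:
  fixes f g :: "'a \<Rightarrow> 'k::{real_normed_field, euclidean_space}"
  assumes f: "integrable M f" and g: "integrable M g"
    and pos: "AE \<omega> in M. wnorm a (orbit f \<omega>) > 0"
  shows "((\<lambda>t. (orbit_norm (\<lambda>\<omega>. f \<omega> + t *\<^sub>R g \<omega>) - orbit_norm f) / t)
           \<longlongrightarrow> (\<integral>\<omega>. winner a (orbit f \<omega>) (orbit g \<omega>) / wnorm a (orbit f \<omega>) \<partial>M)) (at 0)"
proof -
  note [measurable] = borel_measurable_integrable[OF f] borel_measurable_integrable[OF g]
  note sums = AE_wsq_summable_orbit[OF f] AE_wsq_summable_orbit[OF g]
  let ?q = "\<lambda>t \<omega>. (wnorm a (\<lambda>k. f (iter k \<omega>) + t *\<^sub>R g (iter k \<omega>)) - wnorm a (orbit f \<omega>)) / t"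
  let ?d = "\<lambda>\<omega>. winner a (orbit f \<omega>) (orbit g \<omega>) / wnorm a (orbit f \<omega>)"
  have quot: "(orbit_norm (\<lambda>\<omega>. f \<omega> + t *\<^sub>R g \<omega>) - orbit_norm f) / t = (\<integral>\<omega>. ?q t \<omega> \<partial>M)" for t
    using integrable_wnorm_orbit[of "\<lambda>\<omega>. f \<omega> + t *\<^sub>R g \<omega>"] integrable_wnorm_orbit[OF f] f g
    by (simp add: orbit_norm_eq)
  have mq: "?q t \<in> borel_measurable M" for t
    using measurable_wnorm_orbit[of "\<lambda>\<omega>. f \<omega> + t *\<^sub>R g \<omega>"] measurable_wnorm_orbit[of f]
    by simp
  have md: "?d \<in> borel_measurable M"
    unfolding winner_def using measurable_wnorm_orbit[of f]
    by (intro borel_measurable_divide measurable_orbit_sum) simp_all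
  show ?thesis
    unfolding quot tendsto_at_iff_sequentially
  proof (intro allI impI)
    fix X :: "nat \<Rightarrow> real"
    assume X: "\<forall>i. X i \<in> UNIV - {0}" "X \<longlonglongrightarrow> 0"
    have "(\<lambda>i. \<integral>\<omega>. ?q (X i) \<omega> \<partial>M) \<longlonglongrightarrow> (\<integral>\<omega>. ?d \<omega> \<partial>M)"
    proof (rule integral_dominated_convergence[where w = "\<lambda>\<omega>. wnorm a (orbit g \<omega>)"])
      show "AE \<omega> in M. (\<lambda>i. ?q (X i) \<omega>) \<longlonglongrightarrow> ?d \<omega>"
        using sums pos
      proof eventually_elim
        case (elim \<omega>)
        from wnorm_has_directional_derivative[OF this] X
        show ?case unfolding tendsto_at_iff_sequentially by (auto simp: o_def)
      qed
      show "AE \<omega> in M. norm (?q (X i) \<omega>) \<le> wnorm a (orbit g \<omega>)" for i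
        using sums
      proof eventually_elim
        case (elim \<omega>)
        from wnorm_difference_bound[OF this, of "X i"] X(1)
        show ?case by (simp add: divide_le_eq mult.commute)
      qed
    qed (simp_all add: mq md integrable_wnorm_orbit[OF g])
    then show "((\<lambda>t. \<integral>\<omega>. ?q t \<omega> \<partial>M) \<circ> X) \<longlonglongrightarrow> (\<integral>\<omega>. ?d \<omega> \<partial>M)"
      by (simp add: o_def)
  qed
qed

end

section \<open>Isometric copies of \<open>\<ell>\<^sub>1\<^sup>2\<close>\<close>

lemma ell1_2_simps [simp]:
  "vcarrier ell1_2 = UNIV"
  "vadd ell1_2 (\<alpha>, \<beta>) (\<gamma>, \<delta>) = (\<alpha> + \<gamma>, \<beta> + \<delta>)"
  "vscale ell1_2 c (\<alpha>, \<beta>) = (c * \<alpha>, c * \<beta>)"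
  "vnorm ell1_2 (\<alpha>, \<beta>) = norm \<alpha> + norm \<beta>"
  by (simp_all add: ell1_2_def)

text \<open>
  An isometric copy of \<open>\<ell>\<^sub>1\<^sup>2\<close> is handled through its parametrization by pairs of scalars: a
  record of operations carries no vector-space laws, and on the copy they are inherited from \<open>\<ell>\<^sub>1\<^sup>2\<close>.
\<close>

definition ell1_embedding :: "('k::real_normed_field, 'v) nspace \<Rightarrow> ('k \<Rightarrow> 'k \<Rightarrow> 'v) \<Rightarrow> bool" where
  "ell1_embedding X \<psi> \<longleftrightarrow>
     (\<forall>\<alpha> \<beta>. \<psi> \<alpha> \<beta> \<in> vcarrier X) \<and>
     (\<forall>\<alpha> \<beta> \<gamma> \<delta>. vadd X (\<psi> \<alpha> \<beta>) (\<psi> \<gamma> \<delta>) = \<psi> (\<alpha> + \<gamma>) (\<beta> + \<delta>)) \<and>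
     (\<forall>c \<alpha> \<beta>. vscale X c (\<psi> \<alpha> \<beta>) = \<psi> (c * \<alpha>) (c * \<beta>)) \<and>
     (\<forall>\<alpha> \<beta>. vnorm X (\<psi> \<alpha> \<beta>) = norm \<alpha> + norm \<beta>)"

text \<open>
  The difference of two parameters with the same image is formed in the domain of the embedding; it
  is sent to the image of zero, so its own norm vanishes.
\<close>

lemma ell1_embedding_inject:
  assumes "ell1_embedding X \<psi>" "\<psi> \<alpha> \<beta> = \<psi> \<gamma> \<delta>"
  shows "\<alpha> = \<gamma> \<and> \<beta> = \<delta>"
proof -
  have "\<psi> (\<alpha> - \<gamma>) (\<beta> - \<delta>) = vadd X (\<psi> \<alpha> \<beta>) (\<psi> (- \<gamma>) (- \<delta>))"
    using assms(1) by (simp add: ell1_embedding_def)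
  also have "\<dots> = \<psi> 0 0"
    using assms by (simp add: ell1_embedding_def)
  finally have "vnorm X (\<psi> (\<alpha> - \<gamma>) (\<beta> - \<delta>)) = vnorm X (\<psi> 0 0)" by simp
  then have "norm (\<alpha> - \<gamma>) + norm (\<beta> - \<delta>) = 0"
    using assms(1) by (simp add: ell1_embedding_def)
  then show ?thesis by (simp add: add_nonneg_eq_0_iff)
qed

lemma contains_ell1_2_iff: "contains_isometric_copy X ell1_2 \<longleftrightarrow> (\<exists>\<psi>. ell1_embedding X \<psi>)"
proof
  assume "contains_isometric_copy X ell1_2"
  then obtain Y \<phi> where Y: "linear_subspace Y X" and bij: "bij_betw \<phi> Y UNIV"
    and hom: "\<forall>x\<in>Y. \<forall>y\<in>Y. \<phi> (vadd X x y) = vadd ell1_2 (\<phi> x) (\<phi> y)"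
      "\<forall>c. \<forall>x\<in>Y. \<phi> (vscale X c x) = vscale ell1_2 c (\<phi> x)"
      "\<forall>x\<in>Y. vnorm ell1_2 (\<phi> x) = vnorm X x"
    by (auto simp: contains_isometric_copy_def linearly_isometric_def)
  define \<psi> where "\<psi> \<alpha> \<beta> = inv_into Y \<phi> (\<alpha>, \<beta>)" for \<alpha> \<beta>
  have \<psi>Y: "\<psi> \<alpha> \<beta> \<in> Y" and \<phi>\<psi>: "\<phi> (\<psi> \<alpha> \<beta>) = (\<alpha>, \<beta>)" for \<alpha> \<beta>
    using bij_betw_imp_surj_on[OF bij] by (auto simp: \<psi>_def inv_into_into f_inv_into_f)
  have \<psi>I: "x = \<psi> \<alpha> \<beta>" if "x \<in> Y" "\<phi> x = (\<alpha>, \<beta>)" for x \<alpha> \<beta>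
    using that \<psi>Y \<phi>\<psi> bij_betw_imp_inj_on[OF bij] by (metis inj_onD)
  have "ell1_embedding X \<psi>"
    unfolding ell1_embedding_def
  proof (intro conjI allI)
    fix \<alpha> \<beta> \<gamma> \<delta> c
    show "\<psi> \<alpha> \<beta> \<in> vcarrier X" using Y \<psi>Y by (auto simp: linear_subspace_def)
    show "vadd X (\<psi> \<alpha> \<beta>) (\<psi> \<gamma> \<delta>) = \<psi> (\<alpha> + \<gamma>) (\<beta> + \<delta>)"
      using Y hom(1) \<psi>Y by (intro \<psi>I) (auto simp: linear_subspace_def \<phi>\<psi>)
    show "vscale X c (\<psi> \<alpha> \<beta>) = \<psi> (c * \<alpha>) (c * \<beta>)"
      using Y hom(2) \<psi>Y by (intro \<psi>I) (auto simp: linear_subspace_def \<phi>\<psi>)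
    show "vnorm X (\<psi> \<alpha> \<beta>) = norm \<alpha> + norm \<beta>"
      using hom(3) \<psi>Y[of \<alpha> \<beta>] \<phi>\<psi>[of \<alpha> \<beta>] by (metis ell1_2_simps(4))
  qed
  then show "\<exists>\<psi>. ell1_embedding X \<psi>" by blast
next
  assume "\<exists>\<psi>. ell1_embedding X \<psi>"
  then obtain \<psi> where \<psi>: "ell1_embedding X \<psi>" ..
  let ?\<psi> = "\<lambda>(\<alpha>, \<beta>). \<psi> \<alpha> \<beta>"
  have inj: "inj ?\<psi>"
    using ell1_embedding_inject[OF \<psi>] by (auto intro!: injI)
  have "linear_subspace (range ?\<psi>) X"
    using \<psi> by (auto simp: linear_subspace_def ell1_embedding_def image_iff)
  moreover have "linearly_isometric (X\<lparr>vcarrier := range ?\<psi>\<rparr>) ell1_2"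
    unfolding linearly_isometric_def
  proof (intro exI conjI)
    show "bij_betw (inv ?\<psi>) (vcarrier (X\<lparr>vcarrier := range ?\<psi>\<rparr>)) (vcarrier ell1_2)"
      using inj by (simp add: inj_imp_bij_betw_inv)
  qed (use \<psi> inv_f_f[OF inj] in \<open>auto simp: ell1_embedding_def split_paired_all\<close>)
  ultimately show "contains_isometric_copy X ell1_2"
    by (auto simp: contains_isometric_copy_def)
qed

text \<open>
  The two unit vectors of \<open>\<ell>\<^sub>1\<^sup>2\<close> have a midpoint of norm one.
\<close>

lemma strictly_convex_imp_no_ell1_2:
  assumes "strictly_convex X"
  shows "\<not> contains_isometric_copy X ell1_2"
proof
  assume "contains_isometric_copy X ell1_2"
  then obtain \<psi> where \<psi>: "ell1_embedding X \<psi>" by (auto simp: contains_ell1_2_iff)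
  have "\<psi> 1 0 \<noteq> \<psi> 0 1" using ell1_embedding_inject[OF \<psi>, of 1 0 0 1] by auto
  moreover have "\<psi> 1 0 \<in> unit_sphere X" "\<psi> 0 1 \<in> unit_sphere X"
    using \<psi> by (simp_all add: unit_sphere_def ell1_embedding_def)
  ultimately have "vnorm X (vscale X (1 / 2) (vadd X (\<psi> 1 0) (\<psi> 0 1))) < 1"
    using assms by (simp add: strictly_convex_def)
  then show False
    using \<psi> by (simp add: ell1_embedding_def norm_divide)
qed

text \<open>
  In \<open>\<ell>\<^sub>1\<^sup>2\<close> the norm at \<open>(1, 0)\<close> in direction \<open>(0, 1)\<close> has the difference quotient \<open>\<bar>t\<bar> / t\<close>.
\<close>

lemma gateaux_smooth_imp_no_ell1_2:
  assumes "gateaux_smooth X"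
  shows "\<not> contains_isometric_copy X ell1_2"
proof
  assume "contains_isometric_copy X ell1_2"
  then obtain \<psi> where \<psi>: "ell1_embedding X \<psi>" by (auto simp: contains_ell1_2_iff)
  have "\<psi> 1 0 \<in> unit_sphere X" "\<psi> 0 1 \<in> vcarrier X"
    using \<psi> by (simp_all add: unit_sphere_def ell1_embedding_def)
  then obtain L where
    "((\<lambda>t. (vnorm X (vadd X (\<psi> 1 0) (vscale X (of_real t) (\<psi> 0 1))) - vnorm X (\<psi> 1 0)) / t) \<longlongrightarrow> L) (at 0)"
    using assms by (auto simp: gateaux_smooth_def)
  then have L: "((\<lambda>t. \<bar>t\<bar> / t) \<longlongrightarrow> L) (at (0::real))"
    using \<psi> by (simp add: ell1_embedding_def)
  have "((\<lambda>t. \<bar>t\<bar> / t) \<longlongrightarrow> 1) (at_right (0::real))"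
    by (rule tendsto_eventually) (auto simp: eventually_at_filter)
  moreover have "((\<lambda>t. \<bar>t\<bar> / t) \<longlongrightarrow> L) (at_right (0::real))"
    by (rule tendsto_within_subset[OF L]) simp
  ultimately have "L = 1" by (rule tendsto_unique[OF trivial_limit_at_right_real, rotated])
  have "((\<lambda>t. \<bar>t\<bar> / t) \<longlongrightarrow> - 1) (at_left (0::real))"
    by (rule tendsto_eventually) (auto simp: eventually_at_filter)
  moreover have "((\<lambda>t. \<bar>t\<bar> / t) \<longlongrightarrow> L) (at_left (0::real))"
    by (rule tendsto_within_subset[OF L]) simp
  ultimately have "L = - 1" by (rule tendsto_unique[OF trivial_limit_at_left_real, rotated])
  with \<open>L = 1\<close> show False by simp
qed

section \<open>Operations and norm on classes\<close>

lemma equiv_ae_rel: "equiv {f. integrable M f} (ae_rel M)"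
proof (rule equivI)
  show "trans (ae_rel M)"
  proof (rule transI)
    fix f g h assume "(f, g) \<in> ae_rel M" "(g, h) \<in> ae_rel M"
    then have "integrable M f" "integrable M h" "AE \<omega> in M. f \<omega> = g \<omega>" "AE \<omega> in M. g \<omega> = h \<omega>"
      by (simp_all add: ae_rel_def)
    moreover from this(3,4) have "AE \<omega> in M. f \<omega> = h \<omega>" by eventually_elim simp
    ultimately show "(f, h) \<in> ae_rel M" by (simp add: ae_rel_def)
  qed
qed (auto simp: ae_rel_def refl_on_def sym_def eq_commute)

lemma mem_ae_class:
  "g \<in> ae_rel M `` {f} \<longleftrightarrow> integrable M f \<and> integrable M g \<and> (AE \<omega> in M. f \<omega> = g \<omega>)"
  by (simp add: ae_rel_def)

lemma ae_class_eq_iff: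
  "integrable M f \<Longrightarrow> integrable M g \<Longrightarrow>
     ae_rel M `` {f} = ae_rel M `` {g} \<longleftrightarrow> (AE \<omega> in M. f \<omega> = g \<omega>)"
  by (subst eq_equiv_class_iff[OF equiv_ae_rel]) (simp_all add: ae_rel_def)

lemma L1_orbit_carrier: "F \<in> vcarrier (L1_orbit M T a) \<longleftrightarrow> (\<exists>f. integrable M f \<and> F = ae_rel M `` {f})"
  by (auto simp: L1_orbit_def quotient_def)

lemma L1_orbit_add:
  assumes "integrable M f" "integrable M g"
  shows "vadd (L1_orbit M T a) (ae_rel M `` {f}) (ae_rel M `` {g}) = ae_rel M `` {\<lambda>\<omega>. f \<omega> + g \<omega>}"
proof -
  have "ae_rel M `` {\<lambda>\<omega>. f' \<omega> + g' \<omega>} = ae_rel M `` {\<lambda>\<omega>. f \<omega> + g \<omega>}"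
    if "f' \<in> ae_rel M `` {f}" "g' \<in> ae_rel M `` {g}" for f' g'
  proof -
    have "AE \<omega> in M. f \<omega> = f' \<omega>" "AE \<omega> in M. g \<omega> = g' \<omega>" "integrable M f'" "integrable M g'"
      using that unfolding mem_ae_class by simp_all
    moreover from this(1,2) have "AE \<omega> in M. f' \<omega> + g' \<omega> = f \<omega> + g \<omega>"
      by eventually_elim simp
    ultimately show ?thesis using assms by (subst ae_class_eq_iff) simp_all
  qed
  moreover have "f \<in> ae_rel M `` {f}" "g \<in> ae_rel M `` {g}"
    using assms unfolding mem_ae_class by simp_all
  ultimately have "(\<Union>f'\<in>ae_rel M `` {f}. \<Union>g'\<in>ae_rel M `` {g}. ae_rel M `` {\<lambda>\<omega>. f' \<omega> + g' \<omega>})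
      = ae_rel M `` {\<lambda>\<omega>. f \<omega> + g \<omega>}"
    by (intro UN_constant_eq ballI)
  then show ?thesis by (simp only: L1_orbit_def nspace.simps)
qed

lemma L1_orbit_scale:
  assumes "integrable M f"
  shows "vscale (L1_orbit M T a) c (ae_rel M `` {f}) = ae_rel M `` {\<lambda>\<omega>. c * f \<omega>}"
proof -
  have "ae_rel M `` {\<lambda>\<omega>. c * f' \<omega>} = ae_rel M `` {\<lambda>\<omega>. c * f \<omega>}" if "f' \<in> ae_rel M `` {f}" for f'
  proof -
    have "AE \<omega> in M. f \<omega> = f' \<omega>" "integrable M f'"
      using that unfolding mem_ae_class by simp_all
    moreover from this(1) have "AE \<omega> in M. c * f' \<omega> = c * f \<omega>"
      by eventually_elim simp
    ultimately show ?thesis using assms by (subst ae_class_eq_iff) simp_all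
  qed
  moreover have "f \<in> ae_rel M `` {f}" using assms unfolding mem_ae_class by simp
  ultimately have "(\<Union>f'\<in>ae_rel M `` {f}. ae_rel M `` {\<lambda>\<omega>. c * f' \<omega>}) = ae_rel M `` {\<lambda>\<omega>. c * f \<omega>}"
    by (intro UN_constant_eq ballI)
  then show ?thesis by (simp only: L1_orbit_def nspace.simps)
qed

context weighted_system
begin

lemma L1_orbit_norm:
  fixes f :: "'a \<Rightarrow> 'k::{real_normed_field, banach, second_countable_topology}"
  assumes "integrable M f"
  shows "vnorm (L1_orbit M T a) (ae_rel M `` {f}) = orbit_norm f"
proof -
  have "orbit_norm g = orbit_norm f" if "g \<in> ae_rel M `` {f}" for g
    using that unfolding mem_ae_class by (intro orbit_norm_cong[symmetric]) auto
  moreover have "f \<in> ae_rel M `` {f}"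
    using assms unfolding mem_ae_class by simp
  ultimately have "orbit_norm ` (ae_rel M `` {f}) = {orbit_norm f}" by blast
  then show ?thesis by (simp add: L1_orbit_def)
qed

lemmas L1_orbit_simps = L1_orbit_add L1_orbit_scale L1_orbit_norm

lemma orbit_norm_scale:
  fixes f :: "'a \<Rightarrow> 'k::real_normed_field"
  shows "orbit_norm (\<lambda>\<omega>. c * f \<omega>) = norm c * orbit_norm f"
proof -
  have "wnorm a (orbit (\<lambda>\<omega>. c * f \<omega>) \<omega>) = norm c * wnorm a (orbit f \<omega>)" for \<omega>
    using wnorm_scaleR[of "norm c" "orbit f \<omega>"]
      wnorm_norm_cong[of "orbit (\<lambda>\<omega>. c * f \<omega>) \<omega>" "\<lambda>k. norm c *\<^sub>R orbit f \<omega> k" a]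
    by (simp add: norm_mult)
  then show ?thesis by (simp add: orbit_norm_eq)
qed

lemma ergodic_imp_strictly_convex:
  assumes "ergodic M T"
  shows "strictly_convex (L1_orbit M T a :: ('k::{real_normed_field, euclidean_space}, ('a \<Rightarrow> 'k) set) nspace)"
    (is "strictly_convex ?X")
  unfolding strictly_convex_def
proof (intro ballI impI)
  fix F G assume F: "F \<in> unit_sphere ?X" and G: "G \<in> unit_sphere ?X" and "F \<noteq> G"
  from F obtain f where f: "integrable M f" "F = ae_rel M `` {f}" "orbit_norm f = 1"
    by (auto simp: unit_sphere_def L1_orbit_carrier L1_orbit_simps)
  from G obtain g where g: "integrable M g" "G = ae_rel M `` {g}" "orbit_norm g = 1"
    by (auto simp: unit_sphere_def L1_orbit_carrier L1_orbit_simps)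
  have "\<not> (AE \<omega> in M. f \<omega> = g \<omega>)"
    using \<open>F \<noteq> G\<close> f g by (simp add: ae_class_eq_iff)
  then have "orbit_norm (\<lambda>\<omega>. f \<omega> + g \<omega>) < 2"
    using orbit_norm_strict_triangle[OF assms f(1,3) g(1,3)] by fastforce
  then show "vnorm ?X (vscale ?X (1 / 2) (vadd ?X F G)) < 1"
    using f(1) g(1) orbit_norm_scale[of "1 / 2" "\<lambda>\<omega>. f \<omega> + g \<omega>"]
    by (simp add: f(2) g(2) L1_orbit_simps norm_divide)
qed

lemma ergodic_imp_gateaux_smooth:
  assumes "ergodic M T"
  shows "gateaux_smooth (L1_orbit M T a :: ('k::{real_normed_field, euclidean_space}, ('a \<Rightarrow> 'k) set) nspace)"
    (is "gateaux_smooth ?X")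
  unfolding gateaux_smooth_def
proof (intro ballI)
  fix F G assume F: "F \<in> unit_sphere ?X" and G: "G \<in> vcarrier ?X"
  from F obtain f where f: "integrable M f" "F = ae_rel M `` {f}" "orbit_norm f = 1"
    by (auto simp: unit_sphere_def L1_orbit_carrier L1_orbit_simps)
  from G obtain g where g: "integrable M g" "G = ae_rel M `` {g}"
    by (auto simp: L1_orbit_carrier)
  have "AE \<omega> in M. wnorm a (orbit f \<omega>) > 0"
    using AE_wnorm_orbit_pos[OF assms f(1)] f(3) by simp
  from orbit_norm_directional_derivative[OF f(1) g(1) this]
  show "\<exists>L. ((\<lambda>t. (vnorm ?X (vadd ?X F (vscale ?X (of_real t) G)) - vnorm ?X F) / t) \<longlongrightarrow> L) (at 0)"
    using f(1) g(1) by (auto simp: f(2) g(2) L1_orbit_simps scaleR_conv_of_real)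
qed

lemma AE_invariant_orbit:
  assumes "AE \<omega> in M. T \<omega> \<in> A \<longleftrightarrow> \<omega> \<in> A"
  shows "AE \<omega> in M. \<forall>k. iter k \<omega> \<in> A \<longleftrightarrow> \<omega> \<in> A"
  using AE_all_iter[OF assms] AE_space
proof eventually_elim
  case (elim \<omega>)
  then have step: "iter (k + 1) \<omega> \<in> A \<longleftrightarrow> iter k \<omega> \<in> A" for k
    by (simp add: iter_T)
  show ?case
  proof
    fix k
    show "iter k \<omega> \<in> A \<longleftrightarrow> \<omega> \<in> A"
    proof (induction k rule: int_induct[where k = 0])
      case (step2 i)
      then show ?case using step[of "i - 1"] by simp
    qed (simp_all add: iter_0 step)
  qed
qed

text \<open>
  A function that is constant along orbits sees only the total weight, which is \<open>1\<close>; on such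
  functions the orbit norm is the usual norm of \<open>L\<^sub>1\<close>.
\<close>

lemma orbit_norm_invariant:
  assumes "f \<in> borel_measurable M" "AE \<omega> in M. \<forall>k. f (iter k \<omega>) = f \<omega>"
  shows "orbit_norm f = (\<integral>\<omega>. norm (f \<omega>) \<partial>M)"
  unfolding orbit_norm_eq
proof (rule integral_cong_AE)
  show "AE \<omega> in M. wnorm a (orbit f \<omega>) = norm (f \<omega>)"
    using assms(2)
  proof eventually_elim
    case (elim \<omega>)
    then show ?case
      using infsumI[OF a_sum] by (simp add: wnorm_def infsum_cmult_left' real_sqrt_mult)
  qed
qed (use assms(1) in measurable)

text \<open>
  If \<open>A\<close> is invariant with \<open>0 < \<mu>(A) < 1\<close>, then \<open>1\<^sub>A / \<mu>(A)\<close> and its counterpart for the complement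
  are constant along orbits and have disjoint supports, so they span a copy of \<open>\<ell>\<^sub>1\<^sup>2\<close>.
\<close>

lemma not_ergodic_imp_ell1_2:
  assumes "\<not> ergodic M T"
  shows "contains_isometric_copy
    (L1_orbit M T a :: ('k::{real_normed_field, euclidean_space}, ('a \<Rightarrow> 'k) set) nspace) ell1_2"
    (is "contains_isometric_copy ?X _")
proof -
  from assms obtain A where A [measurable]: "A \<in> sets M"
    and inv: "prob (sym_diff A (T -` A \<inter> space M)) = 0" and ne: "prob A \<noteq> 0" "prob A \<noteq> 1"
    by (auto simp: ergodic_def)
  define p where "p = prob A"
  have p: "0 < p" "p < 1"
    using ne prob_le_1[of A] measure_nonneg[of M A] by (auto simp: p_def less_le)
  have orbA: "AE \<omega> in M. \<forall>k. iter k \<omega> \<in> A \<longleftrightarrow> \<omega> \<in> A"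
    using inv measure_sym_diff_zero_iff[OF A] by (intro AE_invariant_orbit) simp
  define h :: "'k \<Rightarrow> 'k \<Rightarrow> 'a \<Rightarrow> 'k"
    where "h \<alpha> \<beta> \<omega> = (if \<omega> \<in> A then \<alpha> / of_real p else \<beta> / of_real (1 - p))" for \<alpha> \<beta> \<omega>
  have mh: "h \<alpha> \<beta> \<in> borel_measurable M" for \<alpha> \<beta>
    unfolding h_def by measurable
  have ih: "integrable M (h \<alpha> \<beta>)" for \<alpha> \<beta>
    by (rule integrable_const_bound[OF _ mh, where B = "norm (\<alpha> / of_real p) + norm (\<beta> / of_real (1 - p))"])
       (auto simp: h_def)
  have norm_h: "orbit_norm (h \<alpha> \<beta>) = norm \<alpha> + norm \<beta>" for \<alpha> \<beta>
  proof -
    have "AE \<omega> in M. \<forall>k. h \<alpha> \<beta> (iter k \<omega>) = h \<alpha> \<beta> \<omega>"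
      using orbA by eventually_elim (simp add: h_def)
    then have "orbit_norm (h \<alpha> \<beta>) = (\<integral>\<omega>. norm (h \<alpha> \<beta> \<omega>) \<partial>M)"
      by (rule orbit_norm_invariant[OF mh])
    also have "\<dots> = (\<integral>\<omega>. indicator A \<omega> * (norm \<alpha> / p) + indicator (space M - A) \<omega> * (norm \<beta> / (1 - p)) \<partial>M)"
      using p by (intro Bochner_Integration.integral_cong refl) (auto simp: h_def norm_divide simp del: of_real_diff)
    also have "\<dots> = p * (norm \<alpha> / p) + (1 - p) * (norm \<beta> / (1 - p))"
      by (simp add: p_def prob_compl emeasure_eq_measure)
    finally show ?thesis using p by simp
  qed
  have "ell1_embedding ?X (\<lambda>\<alpha> \<beta>. ae_rel M `` {h \<alpha> \<beta>})"
    unfolding ell1_embedding_def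
  proof (intro conjI allI)
    fix \<alpha> \<beta> \<gamma> \<delta> c :: 'k
    show "ae_rel M `` {h \<alpha> \<beta>} \<in> vcarrier ?X"
      using ih by (auto simp: L1_orbit_carrier)
    have "(\<lambda>\<omega>. h \<alpha> \<beta> \<omega> + h \<gamma> \<delta> \<omega>) = h (\<alpha> + \<gamma>) (\<beta> + \<delta>)"
      by (auto simp: h_def add_divide_distrib)
    then show "vadd ?X (ae_rel M `` {h \<alpha> \<beta>}) (ae_rel M `` {h \<gamma> \<delta>}) = ae_rel M `` {h (\<alpha> + \<gamma>) (\<beta> + \<delta>)}"
      by (simp add: L1_orbit_simps ih)
    have "(\<lambda>\<omega>. c * h \<alpha> \<beta> \<omega>) = h (c * \<alpha>) (c * \<beta>)"
      by (auto simp: h_def)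
    then show "vscale ?X c (ae_rel M `` {h \<alpha> \<beta>}) = ae_rel M `` {h (c * \<alpha>) (c * \<beta>)}"
      by (simp add: L1_orbit_simps ih)
    show "vnorm ?X (ae_rel M `` {h \<alpha> \<beta>}) = norm \<alpha> + norm \<beta>"
      by (simp add: L1_orbit_simps ih norm_h)
  qed
  then show ?thesis by (auto simp: contains_ell1_2_iff)
qed

text \<open>
  The class of Euclidean spaces that are normed fields covers the real and the complex scalars at
  once; the inner product is \<open>Re (x \<cdot> conj y)\<close> in the complex case.
\<close>

lemma ergodic_characterizations:
  defines "X \<equiv> L1_orbit M T a :: ('k::{real_normed_field, euclidean_space}, ('a \<Rightarrow> 'k) set) nspace"
  shows "(ergodic M T \<longleftrightarrow> strictly_convex X) \<and> (ergodic M T \<longleftrightarrow> gateaux_smooth X) \<and>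
         (ergodic M T \<longleftrightarrow> \<not> contains_isometric_copy X ell1_2)"
  unfolding X_def
  using ergodic_imp_strictly_convex ergodic_imp_gateaux_smooth not_ergodic_imp_ell1_2
    strictly_convex_imp_no_ell1_2 gateaux_smooth_imp_no_ell1_2 by blast

end

theorem theorem3p4:
  fixes M :: "'a measure" and T :: "'a \<Rightarrow> 'a" and a :: "int \<Rightarrow> real"
  assumes "prob_space M"
    and "invertible_mpt M T"
    and "\<And>k. a k > 0"
    and "(a has_sum 1) UNIV"
    and "(\<lambda>k. sqrt (a k)) summable_on UNIV"
  shows "(let X = (L1_orbit M T a :: (real, ('a \<Rightarrow> real) set) nspace) in
            (ergodic M T \<longleftrightarrow> strictly_convex X) \<and>
            (ergodic M T \<longleftrightarrow> gateaux_smooth X) \<and>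
            (ergodic M T \<longleftrightarrow> \<not> contains_isometric_copy X ell1_2)) \<and>
         (let X = (L1_orbit M T a :: (complex, ('a \<Rightarrow> complex) set) nspace) in
            (ergodic M T \<longleftrightarrow> strictly_convex X) \<and>
            (ergodic M T \<longleftrightarrow> gateaux_smooth X) \<and>
            (ergodic M T \<longleftrightarrow> \<not> contains_isometric_copy X ell1_2))"
proof -
  interpret prob_space M by fact
  interpret weighted_system M T a
    using assms(2-5) by unfold_locales
  show ?thesis
    unfolding Let_def by (intro conjI[OF ergodic_characterizations ergodic_characterizations])
qed

end
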